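(* Let $d\ge 2$, let $A,B$ be linearly independent binary forms of order $d$ over $\mathbf{C}$, and put $T_1=(A,B)_1$, $T_3=(A,B)_3$. If $F$ is a form of order $d$, then $F\in\operatorname{Span}\{A,B\}$ if and only if $$(T_1,F)_2-\frac{d-2}{4d-6}\,T_3\,F=0.$$
   Context: All forms are over $\mathbf{C}$. A form of order $e$ is a homogeneous polynomial of degree $e$ in $(x_0,x_1)$; $S_e$ is the space of such forms, with $S_e=0$ for $e<0$. For $E\in S_e$, $F\in S_f$ and $0\le r\le\min\{e,f\}$, the $r$-th transvectant is $$(E,F)_r=\frac{(e-r)!(f-r)!}{e!f!}\sum_{i=0}^r(-1)^i\binom{r}{i}\frac{\partial^rE}{\partial x_0^{r-i}\partial x_1^i}\,\frac{\partial^rF}{\partial x_0^i\partial x_1^{r-i}}\in S_{e+f-2r},$$ and $(E,F)_r=0$ for $r>\min\{e,f\}$. *)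

theory Defs
  imports Complex_Main "HOL-Computational_Algebra.Polynomial"
begin

(* C[x0,x1] is represented as (C[x0])[x1]: the coefficient of x0^i x1^j in E is
   coeff (coeff E j) i, so x1 is the outer variable and x0 the inner one. *)

type_synonym bipoly = "complex poly poly"

definition bscale :: "complex \<Rightarrow> bipoly \<Rightarrow> bipoly" where
  "bscale c E = smult [:c:] E"

global_interpretation bipoly: vector_space bscale
  by standard (simp_all add: bscale_def smult_add_right smult_add_left [symmetric] mult.commute
      one_pCons [symmetric])

(* The zero polynomial is a form of every order, so the order of a form is not
   determined by the form and is passed explicitly to the transvectant. *)

definition forms :: "nat \<Rightarrow> bipoly set" where
  "forms e = {E. \<forall>i j. coeff (coeff E j) i \<noteq> 0 \<longrightarrow> i + j = e}"

definition partial0 :: "bipoly \<Rightarrow> bipoly" where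
  "partial0 E = map_poly pderiv E"

definition partial1 :: "bipoly \<Rightarrow> bipoly" where
  "partial1 E = pderiv E"

(* transvectant e f r E F is (E,F)_r for E of order e and F of order f. *)

definition transvectant :: "nat \<Rightarrow> nat \<Rightarrow> nat \<Rightarrow> bipoly \<Rightarrow> bipoly \<Rightarrow> bipoly" where
  "transvectant e f r E F =
    (if r \<le> min e f then
       bscale ((fact (e - r) * fact (f - r)) / (fact e * fact f))
         (\<Sum>i = 0..r. bscale ((-1) ^ i * of_nat (r choose i))
            ((partial0 ^^ (r - i)) ((partial1 ^^ i) E) *
             (partial0 ^^ i) ((partial1 ^^ (r - i)) F)))
     else 0)"

end

theory Submission
  imports Defs
begin

text \<open>
  The left-hand side of the criterion is a Wronskian in disguise. Let \<open>W\<close> be the determinant whose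
  rows are the second partials \<open>(E00, E01, E11)\<close> of \<open>E = A, B, F\<close>. Then
  \<open>(T1, F)_2 - (d - 2) / (4 d - 6) T3 F = W / (d (d - 1))^3\<close>, which is \<open>transvectant_identity\<close>.
  To see this, differentiate \<open>A0 B1 - A1 B0\<close>, which is \<open>T1\<close> up to a constant, twice: Euler's relation
  for the partials of \<open>A\<close> and \<open>B\<close> turns each second partial of it into a multiple of a 2 by 2 minor of
  the rows of \<open>A\<close> and \<open>B\<close>, plus a multiple of \<open>x1^2 T3\<close>, \<open>x0 x1 T3\<close> or \<open>x0^2 T3\<close>. Paired with the
  second partials of \<open>F\<close>, the minors give \<open>W\<close> and the rest gives
  \<open>(x0^2 F00 + 2 x0 x1 F01 + x1^2 F11) T3\<close>, which by Euler's relation is \<open>d (d - 1) F T3\<close>.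

  Euler's relation also turns \<open>x0^3 W\<close> into a nonzero constant times the Wronskian of \<open>A\<close>, \<open>B\<close>, \<open>F\<close> as
  polynomials in \<open>x1\<close> (\<open>second_partials_det_eq_wronskian3\<close>). So the criterion says that this
  Wronskian vanishes. It vanishes for \<open>F\<close> in the span by multilinearity. Conversely, if \<open>F\<close> is not in
  the span, row operations with complex coefficients make the three degrees in \<open>x1\<close> distinct, and
  then the leading coefficient of the Wronskian is a nonzero multiple of a Vandermonde determinant
  of distinct integers (\<open>wronskian3_nonzero\<close>).
\<close>

section \<open>Partial derivatives of forms and the Euler relations\<close>

definition X0 :: bipoly where "X0 = [:[:0, 1:]:]"
definition X1 :: bipoly where "X1 = [:0, 1:]"

lemma coeff_X0_mult: "coeff (X0 * E) j = pCons 0 (coeff E j)"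
  by (simp add: X0_def)

lemma coeff_X1_mult: "coeff (X1 * E) j = (case j of 0 \<Rightarrow> 0 | Suc k \<Rightarrow> coeff E k)"
  by (simp add: X1_def coeff_pCons)

lemma coeff_partial0: "coeff (partial0 E) j = pderiv (coeff E j)"
  by (simp add: partial0_def coeff_map_poly)

lemma coeff_partial1: "coeff (partial1 E) j = of_nat (Suc j) * coeff E (Suc j)"
  by (simp add: partial1_def coeff_pderiv)

lemma partial0_add: "partial0 (E + F) = partial0 E + partial0 F"
  by (rule poly_eqI) (simp add: coeff_partial0 pderiv_add)

lemma partial0_diff: "partial0 (E - F) = partial0 E - partial0 F"
  by (rule poly_eqI) (simp add: coeff_partial0 pderiv_diff)

lemma pderiv_sum: "pderiv (\<Sum>i\<in>I. f i) = (\<Sum>i\<in>I. pderiv (f i))"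
  by (induction I rule: infinite_finite_induct) (simp_all add: pderiv_add)

lemma partial0_mult: "partial0 (E * F) = partial0 E * F + E * partial0 F"
  by (rule poly_eqI, unfold coeff_add coeff_partial0 coeff_mult pderiv_sum pderiv_mult sum.distrib)
    (simp add: mult.commute add.commute)

lemma partial1_add: "partial1 (E + F) = partial1 E + partial1 F"
  by (simp add: partial1_def pderiv_add)

lemma partial1_diff: "partial1 (E - F) = partial1 E - partial1 F"
  by (simp add: partial1_def pderiv_diff)

lemma partial1_mult: "partial1 (E * F) = partial1 E * F + E * partial1 F"
  by (simp add: partial1_def pderiv_mult algebra_simps)

lemma partial0_bscale: "partial0 (bscale c E) = bscale c (partial0 E)"
  by (rule poly_eqI) (simp add: bscale_def coeff_partial0 pderiv_smult)

lemma partial1_bscale: "partial1 (bscale c E) = bscale c (partial1 E)"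
  by (simp add: bscale_def partial1_def pderiv_smult)

lemma partial1_partial0: "partial1 (partial0 E) = partial0 (partial1 E)"
proof (rule poly_eqI)
  fix j
  have "pderiv (of_nat m * p) = of_nat m * pderiv p" for m and p :: "complex poly"
    using pderiv_smult[of "of_nat m" p] by (simp add: of_nat_poly)
  then show "coeff (partial1 (partial0 E)) j = coeff (partial0 (partial1 E)) j"
    by (simp only: coeff_partial0 coeff_partial1)
qed

lemmas partial_simps = partial0_add partial0_diff partial0_mult partial1_add partial1_diff
  partial1_mult partial1_partial0

lemma forms_partial0: "E \<in> forms (Suc e) \<Longrightarrow> partial0 E \<in> forms e"
  by (fastforce simp: forms_def coeff_partial0 coeff_pderiv)

lemma forms_partial1:
  assumes "E \<in> forms (Suc e)" shows "partial1 E \<in> forms e"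
  unfolding forms_def
proof (intro CollectI allI impI)
  fix i j
  assume "coeff (coeff (partial1 E) j) i \<noteq> 0"
  then have "coeff (coeff E (Suc j)) i \<noteq> 0"
    by (auto simp: coeff_partial1 of_nat_poly simp del: of_nat_Suc)
  with assms show "i + j = e" by (force simp: forms_def)
qed

lemma of_nat_mult_bscale: "of_nat n * E = bscale (of_nat n) E"
  by (simp add: bscale_def of_nat_poly)

lemma euler:
  assumes "E \<in> forms e"
  shows "X0 * partial0 E + X1 * partial1 E = of_nat e * E"
proof (intro poly_eqI)
  fix i j
  have "coeff (coeff (X0 * partial0 E) j) i = of_nat i * coeff (coeff E j) i"
    by (cases i) (simp_all add: coeff_X0_mult coeff_partial0 coeff_pderiv)
  moreover have "coeff (coeff (X1 * partial1 E) j) i = of_nat j * coeff (coeff E j) i"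
    by (cases j) (simp_all add: coeff_X1_mult coeff_partial1 of_nat_poly del: of_nat_Suc)
  moreover have "(of_nat i + of_nat j) * coeff (coeff E j) i = of_nat e * coeff (coeff E j) i"
    using assms by (cases "coeff (coeff E j) i = 0") (auto simp: forms_def simp flip: of_nat_add)
  ultimately show "coeff (coeff (X0 * partial0 E + X1 * partial1 E) j) i
      = coeff (coeff (of_nat e * E) j) i"
    by (simp add: of_nat_mult_bscale bscale_def distrib_right)
qed

lemma euler_first_partials:
  assumes "E \<in> forms (n + 2)"
  shows "X0 * partial0 (partial0 E) + X1 * partial0 (partial1 E) = (of_nat n + 1) * partial0 E"
    and "X0 * partial0 (partial1 E) + X1 * partial1 (partial1 E) = (of_nat n + 1) * partial1 E"
  using euler[OF forms_partial0, of E "n + 1"] euler[OF forms_partial1, of E "n + 1"] assms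
  by (simp_all add: partial1_partial0 algebra_simps)

lemma euler_second_partials:
  assumes "E \<in> forms (n + 2)"
  shows "X0 * partial0 (partial0 (partial0 E)) + X1 * partial0 (partial0 (partial1 E))
      = of_nat n * partial0 (partial0 E)"
    and "X0 * partial0 (partial0 (partial1 E)) + X1 * partial0 (partial1 (partial1 E))
      = of_nat n * partial0 (partial1 E)"
    and "X0 * partial0 (partial1 (partial1 E)) + X1 * partial1 (partial1 (partial1 E))
      = of_nat n * partial1 (partial1 E)"
  using euler[OF forms_partial0[OF forms_partial0], of E n]
    euler[OF forms_partial0[OF forms_partial1], of E n]
    euler[OF forms_partial1[OF forms_partial1], of E n] assms
  by (simp_all add: partial1_partial0 algebra_simps numeral_2_eq_2)

section \<open>Wronskians of polynomials\<close>

definition det3 :: "'a::comm_ring_1 \<Rightarrow> 'a \<Rightarrow> 'a \<Rightarrow> 'a \<Rightarrow> 'a \<Rightarrow> 'a \<Rightarrow> 'a \<Rightarrow> 'a \<Rightarrow> 'a \<Rightarrow> 'a" where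
  "det3 a1 a2 a3 b1 b2 b3 c1 c2 c3 =
    a1 * (b2 * c3 - b3 * c2) - a2 * (b1 * c3 - b3 * c1) + a3 * (b1 * c2 - b2 * c1)"

definition wronskian3 :: "'a::idom poly \<Rightarrow> 'a poly \<Rightarrow> 'a poly \<Rightarrow> 'a poly" where
  "wronskian3 p q r =
    det3 p (pderiv p) (pderiv (pderiv p)) q (pderiv q) (pderiv (pderiv q))
      r (pderiv r) (pderiv (pderiv r))"

lemma coeff_mult_bound:
  fixes p q :: "'a::comm_semiring_0 poly"
  assumes "degree p \<le> m" "degree q \<le> n"
  shows "coeff (p * q) (m + n) = coeff p m * coeff q n"
proof -
  have "coeff (p * q) (m + n) = (\<Sum>i\<le>m + n. if i = m then coeff p m * coeff q n else 0)"
    unfolding coeff_mult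
  proof (rule sum.cong)
    fix i assume "i \<in> {..m + n}"
    show "coeff p i * coeff q (m + n - i) = (if i = m then coeff p m * coeff q n else 0)"
    proof (cases i m rule: linorder_cases)
      case less
      then have "coeff q (m + n - i) = 0" using assms by (intro coeff_eq_0) simp
      with less show ?thesis by simp
    next
      case greater
      then have "coeff p i = 0" using assms by (intro coeff_eq_0) simp
      with greater show ?thesis by simp
    qed simp
  qed simp
  then show ?thesis by simp
qed

text \<open>In the leading position of the determinant with rows \<open>s\<close>, \<open>\<theta> s\<close>, \<open>\<theta> (\<theta> s)\<close>, where \<open>\<theta> s\<close> is \<open>x\<close>
  times the derivative of \<open>s\<close>, stands the product of the leading coefficients times the Vandermonde determinant
  of the three degrees. The operator \<open>\<theta>\<close> replaces the derivative because it multiplies the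
  coefficient of \<open>x^n\<close> by \<open>n\<close>, without a shift of exponents, and it changes the Wronskian
  only by the factor \<open>x^3\<close>. In characteristic zero distinct degrees stay distinct in the ring.\<close>

lemma wronskian3_nonzero:
  fixes p q r :: "'a::{idom,ring_char_0} poly"
  assumes "p \<noteq> 0" "q \<noteq> 0" "r \<noteq> 0"
    and "degree p \<noteq> degree q" "degree p \<noteq> degree r" "degree q \<noteq> degree r"
  shows "wronskian3 p q r \<noteq> 0"
proof
  assume W: "wronskian3 p q r = 0"
  define \<theta> :: "'a poly \<Rightarrow> 'a poly" where "\<theta> = (\<lambda>s. [:0, 1:] * pderiv s)"
  have coeff_\<theta>: "coeff (\<theta> s) n = of_nat n * coeff s n" for s n
    by (cases n) (simp_all add: \<theta>_def coeff_pderiv del: of_nat_Suc)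
  have deg_\<theta>: "degree (\<theta> s) \<le> degree s" for s
    by (rule degree_le) (simp add: coeff_\<theta> coeff_eq_0)
  have deg_\<theta>2: "degree (\<theta> (\<theta> s)) \<le> degree s" for s
    using deg_\<theta> order_trans by blast
  have \<theta>2: "\<theta> (\<theta> s) = [:0, 1:] * pderiv s + [:0, 1:]^2 * pderiv (pderiv s)" for s
    unfolding \<theta>_def pderiv_mult by (simp add: pderiv_pCons power2_eq_square)
  have triple: "coeff (s * (t * u)) (k + (l + m)) = coeff s k * (coeff t l * coeff u m)"
    if "degree s \<le> k" "degree t \<le> l" "degree u \<le> m" for s t u :: "'a poly" and k l m
    using that degree_mult_le[of t u] by (simp add: coeff_mult_bound)
  let ?D = "det3 p (\<theta> p) (\<theta> (\<theta> p)) q (\<theta> q) (\<theta> (\<theta> q)) r (\<theta> r) (\<theta> (\<theta> r))"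
  have "?D = [:0, 1:]^3 * wronskian3 p q r"
    unfolding \<theta>2 unfolding \<theta>_def wronskian3_def det3_def by algebra
  with W have D0: "?D = 0" by simp
  let ?a = "degree p" and ?b = "degree q" and ?c = "degree r"
  have "coeff ?D (?a + (?b + ?c)) =
      lead_coeff p * lead_coeff q * lead_coeff r *
      ((of_nat ?b - of_nat ?a) * (of_nat ?c - of_nat ?a) * (of_nat ?c - of_nat ?b))"
    unfolding det3_def right_diff_distrib coeff_diff coeff_add
    by (simp add: triple deg_\<theta> deg_\<theta>2 coeff_\<theta>, algebra)
  with D0 assms show False
    by simp
qed

text \<open>Row operations on the first column carry over to the derivatives because the multipliers are
  constants.\<close>

lemma wronskian3_reduce:
  "wronskian3 p (q - smult c p) (r - smult a p - smult b (q - smult c p)) = wronskian3 p q r"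
proof -
  have smult_const: "smult c p = [:c:] * p" for c and p :: "'a poly" by simp
  show ?thesis
    unfolding wronskian3_def det3_def pderiv_diff pderiv_smult
    unfolding smult_const by algebra
qed

lemma wronskian3_comb: "wronskian3 p q (smult a p + smult b q) = 0"
proof -
  have smult_const: "smult c p = [:c:] * p" for c and p :: "'a poly" by simp
  show ?thesis
    unfolding wronskian3_def det3_def pderiv_add pderiv_smult
    unfolding smult_const by algebra
qed

section \<open>The transvectant identity\<close>

definition second_partials_det :: "bipoly \<Rightarrow> bipoly \<Rightarrow> bipoly \<Rightarrow> bipoly" where
  "second_partials_det A B F =
    det3 (partial0 (partial0 A)) (partial0 (partial1 A)) (partial1 (partial1 A))
      (partial0 (partial0 B)) (partial0 (partial1 B)) (partial1 (partial1 B))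
      (partial0 (partial0 F)) (partial0 (partial1 F)) (partial1 (partial1 F))"

text \<open>Powers of Cayley's Omega process: the transvectants without their numerical factor, so that
  the Euler relations can be applied to them by ring arithmetic alone.\<close>

definition omega1 :: "bipoly \<Rightarrow> bipoly \<Rightarrow> bipoly" where
  "omega1 E F = partial0 E * partial1 F - partial1 E * partial0 F"

definition omega2 :: "bipoly \<Rightarrow> bipoly \<Rightarrow> bipoly" where
  "omega2 E F = partial0 (partial0 E) * partial1 (partial1 F)
    - 2 * (partial0 (partial1 E) * partial0 (partial1 F)) + partial1 (partial1 E) * partial0 (partial0 F)"

definition omega3 :: "bipoly \<Rightarrow> bipoly \<Rightarrow> bipoly" where
  "omega3 E F = partial0 (partial0 (partial0 E)) * partial1 (partial1 (partial1 F))
    - 3 * (partial0 (partial0 (partial1 E)) * partial0 (partial1 (partial1 F)))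
    + 3 * (partial0 (partial1 (partial1 E)) * partial0 (partial0 (partial1 F)))
    - partial1 (partial1 (partial1 E)) * partial0 (partial0 (partial0 F))"

text \<open>The second partials of the Jacobian \<open>omega1 A B\<close> contain third partials of \<open>A\<close> and \<open>B\<close>.
  The Euler relations trade those for the minors of the second partials, up to the multiples
  of \<open>Q0\<close> and \<open>Q1\<close>. These stand for \<open>omega2 (partial0 A) B - omega2 (partial0 B) A\<close> and its
  analogue with \<open>partial1\<close>; a second use of the Euler relations shows that they are
  multiples of \<open>T\<close>, which stands for \<open>omega3 A B\<close>. Here \<open>k\<close> is two less than the order of \<open>A\<close> and \<open>B\<close>,
  and the indices of \<open>a\<close> and \<open>b\<close> list the variables of differentiation.\<close>

lemma omega1_second_partials:
  fixes x y k :: "'a::idom"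
  assumes "x * a00 + y * a01 = (k + 1) * a0" "x * a01 + y * a11 = (k + 1) * a1"
    and "x * a000 + y * a001 = k * a00" "x * a001 + y * a011 = k * a01" "x * a011 + y * a111 = k * a11"
    and "x * b00 + y * b01 = (k + 1) * b0" "x * b01 + y * b11 = (k + 1) * b1"
    and "x * b000 + y * b001 = k * b00" "x * b001 + y * b011 = k * b01" "x * b011 + y * b111 = k * b11"
  defines "Q0 \<equiv> a000 * b11 - 2 * (a001 * b01) + a011 * b00
      - (b000 * a11 - 2 * (b001 * a01) + b011 * a00)"
    and "Q1 \<equiv> a001 * b11 - 2 * (a011 * b01) + a111 * b00
      - (b001 * a11 - 2 * (b011 * a01) + b111 * a00)"
    and "T \<equiv> a000 * b111 - 3 * (a001 * b011) + 3 * (a011 * b001) - a111 * b000"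
  shows "(k + 1) * (a000 * b1 + 2 * a00 * b01 + a0 * b001 - a001 * b0 - 2 * a01 * b00 - a1 * b000)
      = (4 * k + 2) * (a00 * b01 - a01 * b00) + y * Q0"
    and "(k + 1) * (a001 * b1 + a00 * b11 + a0 * b011 - a011 * b0 - a11 * b00 - a1 * b001)
      = (2 * k + 1) * (a00 * b11 - a11 * b00) - x * Q0"
    and "(k + 1) * (a011 * b1 + 2 * a01 * b11 + a0 * b111 - a111 * b0 - 2 * a11 * b01 - a1 * b011)
      = (4 * k + 2) * (a01 * b11 - a11 * b01) - x * Q1"
    and "k * Q0 = y * T"
    and "k * Q1 = - x * T"
  unfolding Q0_def Q1_def T_def using assms(1-10) by algebra+

text \<open>The common source of the transvectant identity: the parts of the second partials of
  \<open>omega1 A B\<close> that are minors give the determinant, expanded along the row of \<open>F\<close>, and the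
  remainder assembles to \<open>omega3 A B\<close> times
  \<open>X0^2 * F00 + 2 * X0 * X1 * F01 + X1^2 * F11\<close>, where \<open>F00\<close>, \<open>F01\<close>, \<open>F11\<close> are the second partials
  of \<open>F\<close>; by Euler that quadratic expression is a multiple of \<open>F\<close>. For \<open>n = 0\<close> the division by
  zero makes the last summand vanish, as it must, since third partials of quadratic forms are zero.\<close>

lemma omega2_omega1:
  assumes A: "A \<in> forms (n + 2)" and B: "B \<in> forms (n + 2)" and F: "F \<in> forms (n + 2)"
  shows "bscale (of_nat (n + 1)) (omega2 (omega1 A B) F)
    = bscale (of_nat (4 * n + 2)) (second_partials_det A B F)
      + bscale (of_nat ((n + 1) * (n + 2)) / of_nat n) (omega3 A B * F)"
proof -
  define T where "T = omega3 A B"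
  define J where "J = omega1 A B"
  note ring = omega1_second_partials[OF euler_first_partials[OF A] euler_second_partials[OF A]
      euler_first_partials[OF B] euler_second_partials[OF B]]
  define Q0 where "Q0 = omega2 (partial0 A) B - omega2 (partial0 B) A"
  define Q1 where "Q1 = omega2 (partial1 A) B - omega2 (partial1 B) A"
  define Z where "Z = X1 * Q0 * partial1 (partial1 F) + 2 * X0 * Q0 * partial0 (partial1 F)
      - X0 * Q1 * partial0 (partial0 F)"
  have J00: "(of_nat n + 1) * partial0 (partial0 J) = (4 * of_nat n + 2) *
      (partial0 (partial0 A) * partial0 (partial1 B) - partial0 (partial1 A) * partial0 (partial0 B))
      + X1 * Q0"
    unfolding Q0_def omega2_def partial1_partial0 ring(1)[symmetric] J_def omega1_def partial_simps
    by algebra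
  have J01: "(of_nat n + 1) * partial0 (partial1 J) = (2 * of_nat n + 1) *
      (partial0 (partial0 A) * partial1 (partial1 B) - partial1 (partial1 A) * partial0 (partial0 B))
      - X0 * Q0"
    unfolding Q0_def omega2_def partial1_partial0 ring(2)[symmetric] J_def omega1_def partial_simps
    by algebra
  have J11: "(of_nat n + 1) * partial1 (partial1 J) = (4 * of_nat n + 2) *
      (partial0 (partial1 A) * partial1 (partial1 B) - partial1 (partial1 A) * partial0 (partial1 B))
      - X0 * Q1"
    unfolding Q1_def omega2_def partial1_partial0 ring(3)[symmetric] J_def omega1_def partial_simps
    by algebra
  have nQ0: "of_nat n * Q0 = X1 * T"
    using ring(4) unfolding Q0_def T_def omega2_def omega3_def partial1_partial0 .
  have nQ1: "of_nat n * Q1 = - X0 * T"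
    using ring(5) unfolding Q1_def T_def omega2_def omega3_def partial1_partial0 .
  have main: "(of_nat n + 1) * omega2 J F = (4 * of_nat n + 2) * second_partials_det A B F + Z"
    using J00 J01 J11 unfolding omega2_def Z_def second_partials_det_def det3_def by algebra
  have "of_nat n * Z = T * (X0 * (X0 * partial0 (partial0 F) + X1 * partial0 (partial1 F))
      + X1 * (X0 * partial0 (partial1 F) + X1 * partial1 (partial1 F)))"
    using nQ0 nQ1 unfolding Z_def by algebra
  also have "\<dots> = T * ((of_nat n + 1) * (X0 * partial0 F + X1 * partial1 F))"
    unfolding euler_first_partials[OF F] by algebra
  also have "\<dots> = of_nat ((n + 1) * (n + 2)) * (T * F)"
    unfolding euler[OF F] by (simp add: algebra_simps)
  finally have nZ: "of_nat n * Z = of_nat ((n + 1) * (n + 2)) * (T * F)" .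
  have Z: "Z = bscale (of_nat ((n + 1) * (n + 2)) / of_nat n) (T * F)"
  proof (cases "n = 0")
    case True
    have third: "partial0 (partial0 (partial0 E)) = 0" "partial0 (partial0 (partial1 E)) = 0"
      "partial0 (partial1 (partial1 E)) = 0" "partial1 (partial1 (partial1 E)) = 0"
      if "E \<in> forms 2" for E
    proof -
      have "partial0 G = 0 \<and> partial1 G = 0" if "G \<in> forms 0" for G
        using that by (intro conjI poly_eqI)
          (auto simp: forms_def coeff_partial0 coeff_partial1 coeff_pderiv of_nat_poly
            simp del: of_nat_Suc)
      with that show "partial0 (partial0 (partial0 E)) = 0" "partial0 (partial0 (partial1 E)) = 0"
      "partial0 (partial1 (partial1 E)) = 0" "partial1 (partial1 (partial1 E)) = 0"
        by (auto simp: numeral_2_eq_2 forms_partial0 forms_partial1)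
    qed
    have "Q0 = 0" "Q1 = 0"
      using A B True by (simp_all add: Q0_def Q1_def omega2_def partial1_partial0 third del: One_nat_def
          flip: numeral_2_eq_2)
    then show ?thesis using True by (simp add: Z_def)
  next
    case False
    from nZ have "bscale (of_nat n) Z = bscale (of_nat ((n + 1) * (n + 2))) (T * F)"
      by (simp only: of_nat_mult_bscale)
    then have "bscale (1 / of_nat n) (bscale (of_nat n) Z)
        = bscale (1 / of_nat n) (bscale (of_nat ((n + 1) * (n + 2))) (T * F))"
      by simp
    with False show ?thesis by (simp add: bipoly.scale_scale del: of_nat_mult)
  qed
  have "of_nat (n + 1) * omega2 J F = of_nat (4 * n + 2) * second_partials_det A B F + Z"
    using main by (simp add: ac_simps)
  then show ?thesis unfolding of_nat_mult_bscale Z J_def T_def .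
qed

lemma bscale_numeral: "bscale (numeral m) E = numeral m * E"
  using of_nat_mult_bscale[of "numeral m" E] by simp

lemma bscale_mult_left: "bscale c E * F = bscale c (E * F)"
  by (simp add: bscale_def)

lemma transvectant_1:
  "transvectant (Suc m) (Suc n) 1 E F = bscale (1 / ((of_nat m + 1) * (of_nat n + 1))) (omega1 E F)"
proof -
  have "fact m * fact n / (fact (Suc m) * fact (Suc n)) = 1 / ((of_nat m + 1) * (of_nat n + 1) :: complex)"
    by (simp add: add.commute)
  then show ?thesis
    by (simp add: transvectant_def omega1_def del: fact_Suc)
qed

lemma transvectant_2:
  "transvectant (m + 2) (n + 2) 2 E F =
    bscale (1 / ((of_nat m + 2) * (of_nat m + 1) * (of_nat n + 2) * (of_nat n + 1))) (omega2 E F)"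
proof -
  have fact_2: "fact (l + 2) = (of_nat l + 2) * (of_nat l + 1) * (fact l :: complex)" for l
    by (simp add: numeral_2_eq_2 algebra_simps)
  have "fact m * fact n / (fact (m + 2) * fact (n + 2))
      = 1 / ((of_nat m + 2) * (of_nat m + 1) * (of_nat n + 2) * (of_nat n + 1) :: complex)"
    unfolding fact_2 by simp
  moreover have "(\<Sum>i = 0..2. bscale ((-1) ^ i * of_nat (2 choose i))
            ((partial0 ^^ (2 - i)) ((partial1 ^^ i) E) * (partial0 ^^ i) ((partial1 ^^ (2 - i)) F)))
     = omega2 E F"
    by (simp add: eval_nat_numeral)
      (simp add: omega2_def bscale_numeral flip: numeral_2_eq_2)
  ultimately show ?thesis
    by (simp add: transvectant_def)
qed

lemma transvectant_3:
  "transvectant (m + 3) (n + 3) 3 E F =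
    bscale (1 / ((of_nat m + 3) * (of_nat m + 2) * (of_nat m + 1)
      * (of_nat n + 3) * (of_nat n + 2) * (of_nat n + 1))) (omega3 E F)"
proof -
  have fact_3: "fact (l + 3) = (of_nat l + 3) * (of_nat l + 2) * (of_nat l + 1) * (fact l :: complex)" for l
    by (simp add: numeral_3_eq_3 algebra_simps)
  have "fact m * fact n / (fact (m + 3) * fact (n + 3))
      = 1 / ((of_nat m + 3) * (of_nat m + 2) * (of_nat m + 1)
          * (of_nat n + 3) * (of_nat n + 2) * (of_nat n + 1) :: complex)"
    unfolding fact_3 by simp
  moreover have "(\<Sum>i = 0..3. bscale ((-1) ^ i * of_nat (3 choose i))
            ((partial0 ^^ (3 - i)) ((partial1 ^^ i) E) * (partial0 ^^ i) ((partial1 ^^ (3 - i)) F)))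
     = omega3 E F"
    by (simp add: eval_nat_numeral)
      (simp add: omega3_def bscale_numeral flip: numeral_3_eq_3)
  ultimately show ?thesis
    by (simp add: transvectant_def)
qed

text \<open>The constant \<open>(d - 2) / (4 * d - 6)\<close> is the one for which the multiples of
  \<open>omega3 A B * F\<close> cancel, so that only the part alternating in \<open>A\<close>, \<open>B\<close>, \<open>F\<close> is left.\<close>

lemma transvectant_identity:
  assumes A: "A \<in> forms d" and B: "B \<in> forms d" and F: "F \<in> forms d" and d: "d \<ge> 2"
  shows "transvectant (2 * d - 2) d 2 (transvectant d d 1 A B) F
      - bscale ((of_nat d - 2) / (4 * of_nat d - 6)) (transvectant d d 3 A B * F)
    = bscale (1 / (of_nat d * (of_nat d - 1)) ^ 3) (second_partials_det A B F)"
proof -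
  obtain n where n: "d = n + 2" using d by (metis add.commute le_Suc_ex)
  define k :: complex where "k = of_nat n"
  have nz: "k + 1 \<noteq> 0" "k + 2 \<noteq> 0" "2 * k + 1 \<noteq> 0"
  proof -
    have "of_nat (n + 1) \<noteq> (0::complex)" "of_nat (n + 2) \<noteq> (0::complex)" "of_nat (2 * n + 1) \<noteq> (0::complex)"
      by (simp_all only: of_nat_eq_0_iff)
    then show "k + 1 \<noteq> 0" "k + 2 \<noteq> 0" "2 * k + 1 \<noteq> 0"
      by (simp_all add: k_def add.commute)
  qed
  have T1: "transvectant d d 1 A B = bscale (1 / (k + 2) ^ 2) (omega1 A B)"
    using transvectant_1[of "Suc n" "Suc n" A B]
    by (simp add: n k_def power2_eq_square add.commute add.left_commute)
  have T2: "transvectant (2 * d - 2) d 2 (bscale c (omega1 A B)) F =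
      bscale (c / ((2 * k + 2) * (2 * k + 1) * (k + 2) * (k + 1))) (omega2 (omega1 A B) F)" for c
    using transvectant_2[of "2 * n" n "bscale c (omega1 A B)" F]
    by (simp add: n omega2_def k_def partial0_bscale partial1_bscale bscale_mult_left
        bipoly.scale_right_distrib bipoly.scale_right_diff_distrib flip: bscale_numeral)
  have T3: "transvectant d d 3 A B = bscale (1 / ((k + 2) * (k + 1) * k) ^ 2) (omega3 A B)"
  proof (cases n)
    case 0
    then show ?thesis by (simp add: transvectant_def n k_def)
  next
    case (Suc m)
    then have "d = m + 3" and k: "k = of_nat m + 1" by (simp_all add: n k_def)
    then show ?thesis
      using transvectant_3[of m m A B] by (simp add: k power2_eq_square ac_simps)
  qed
  have omega2: "omega2 (omega1 A B) F =
      bscale (1 / (k + 1)) (bscale (4 * k + 2) (second_partials_det A B F)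
        + bscale ((k + 1) * (k + 2) / k) (omega3 A B * F))"
  proof -
    have "bscale (k + 1) (omega2 (omega1 A B) F) = bscale (4 * k + 2) (second_partials_det A B F)
      + bscale ((k + 1) * (k + 2) / k) (omega3 A B * F)"
      using omega2_omega1[OF A[unfolded n] B[unfolded n] F[unfolded n]]
      unfolding k_def by (simp add: algebra_simps)
    then have "bscale (1 / (k + 1)) (bscale (k + 1) (omega2 (omega1 A B) F)) =
        bscale (1 / (k + 1)) (bscale (4 * k + 2) (second_partials_det A B F)
          + bscale ((k + 1) * (k + 2) / k) (omega3 A B * F))"
      by simp
    then show ?thesis using nz by (simp add: bipoly.scale_scale)
  qed
  have eqs: "2 * k + 2 = 2 * (k + 1)" "4 * k + 2 = 2 * (2 * k + 1)" by simp_all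
  \<comment> \<open>\<open>c1\<close> and \<open>c2\<close> compare the coefficients of the determinant and of \<open>omega3 A B * F\<close>.
    For \<open>k = 0\<close> both sides of \<open>c2\<close> are zero.\<close>
  have c1: "1 / (k + 2)\<^sup>2 / ((2 * k + 2) * (2 * k + 1) * (k + 2) * (k + 1)) * (1 / (k + 1) * (4 * k + 2))
      = 1 / ((k + 2) * (k + 1)) ^ 3"
  proof -
    have "1 / l\<^sup>2 / (2 * m * j * l * m) * (1 / m * (2 * j)) = 1 / (l * m) ^ 3"
      if "m \<noteq> 0" "l \<noteq> 0" "j \<noteq> 0" for l m j :: complex
      using that by (simp add: divide_simps power2_eq_square power3_eq_cube)
    from this[OF nz] show ?thesis unfolding eqs .
  qed
  have c2: "1 / (k + 2)\<^sup>2 / ((2 * k + 2) * (2 * k + 1) * (k + 2) * (k + 1))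
        * (1 / (k + 1) * ((k + 1) * (k + 2) / k))
      = k / (4 * k + 2) * (1 / ((k + 2) * (k + 1) * k) ^ 2)"
  proof -
    have "1 / l\<^sup>2 / (2 * m * j * l * m) * (1 / m * (m * l / k)) = k / (2 * j) * (1 / (l * m * k) ^ 2)"
      if "m \<noteq> 0" "l \<noteq> 0" "j \<noteq> 0" for l m j :: complex
      using that by (simp add: divide_simps power2_eq_square)
    from this[OF nz] show ?thesis unfolding eqs .
  qed
  have dk: "of_nat d - 2 = k" "4 * of_nat d - 6 = 4 * k + 2"
      "of_nat d * (of_nat d - 1) = (k + 2) * (k + 1)"
    by (simp_all add: n k_def add.commute)
  show ?thesis
    unfolding T1 T2 T3 omega2 dk bscale_mult_left bipoly.scale_right_distrib bipoly.scale_scale c1 c2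
    by (rule add_diff_cancel_right')
qed

section \<open>Vanishing of the Wronskian and linear dependence\<close>

text \<open>Euler's relation and its first partial turn the columns \<open>(n + 1) * (n + 2) * E\<close> and
  \<open>(n + 1) * partial1 E\<close> into combinations of second partials with a triangular matrix, whose
  diagonal is \<open>X0 ^ 2\<close>, \<open>X0\<close>, \<open>1\<close>.\<close>

lemma second_partials_det_eq_wronskian3:
  assumes A: "A \<in> forms (n + 2)" and B: "B \<in> forms (n + 2)" and F: "F \<in> forms (n + 2)"
  shows "X0 ^ 3 * second_partials_det A B F = (of_nat n + 1) ^ 2 * (of_nat n + 2) * wronskian3 A B F"
proof -
  define k :: bipoly where "k = of_nat n"
  have col: "(k + 1) * (k + 2) * E = X0 ^ 2 * partial0 (partial0 E)
        + 2 * X0 * X1 * partial0 (partial1 E) + X1 ^ 2 * partial1 (partial1 E)"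
      "(k + 1) * partial1 E = X0 * partial0 (partial1 E) + X1 * partial1 (partial1 E)"
    if "E \<in> forms (n + 2)" for E
  proof -
    have "X0 * partial0 E + X1 * partial1 E = (k + 2) * E"
      using euler[OF that] by (simp add: k_def)
    then show "(k + 1) * (k + 2) * E = X0 ^ 2 * partial0 (partial0 E)
        + 2 * X0 * X1 * partial0 (partial1 E) + X1 ^ 2 * partial1 (partial1 E)"
      using euler_first_partials[OF that] unfolding k_def by algebra
    show "(k + 1) * partial1 E = X0 * partial0 (partial1 E) + X1 * partial1 (partial1 E)"
      using euler_first_partials(2)[OF that] by (simp add: k_def)
  qed
  have "(k + 1) ^ 2 * (k + 2) * wronskian3 A B F =
     det3 ((k + 1) * (k + 2) * A) ((k + 1) * partial1 A) (partial1 (partial1 A))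
       ((k + 1) * (k + 2) * B) ((k + 1) * partial1 B) (partial1 (partial1 B))
       ((k + 1) * (k + 2) * F) ((k + 1) * partial1 F) (partial1 (partial1 F))"
    unfolding wronskian3_def det3_def partial1_def by algebra
  also have "\<dots> = X0 ^ 3 * second_partials_det A B F"
    unfolding col[OF A] col[OF B] col[OF F] second_partials_det_def det3_def by algebra
  finally show ?thesis by (simp add: k_def)
qed

lemma second_partials_det_eq_0_iff:
  assumes "A \<in> forms (n + 2)" "B \<in> forms (n + 2)" "F \<in> forms (n + 2)"
  shows "second_partials_det A B F = 0 \<longleftrightarrow> wronskian3 A B F = 0"
proof -
  have "X0 ^ 3 \<noteq> 0" by (simp add: X0_def)
  moreover have "(of_nat n + 1) ^ 2 * (of_nat n + 2) \<noteq> (0 :: bipoly)"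
  proof -
    have "of_nat ((n + 1) ^ 2 * (n + 2)) \<noteq> (0 :: bipoly)"
      by (simp only: of_nat_eq_0_iff) simp
    then show ?thesis unfolding of_nat_mult of_nat_power of_nat_add by simp
  qed
  ultimately show ?thesis
    using second_partials_det_eq_wronskian3[OF assms] by (metis mult_eq_0_iff)
qed

lemma forms_diff_bscale: "E \<in> forms d \<Longrightarrow> G \<in> forms d \<Longrightarrow> E - bscale c G \<in> forms d"
  by (force simp: forms_def bscale_def)

text \<open>A complex multiple suffices although the coefficients of powers of \<open>x1\<close> are polynomials in
  \<open>x0\<close>: in forms of the same order the coefficients of the same power are monomials of the same
  degree.\<close>

lemma forms_eliminate:
  assumes E: "E \<in> forms d" and G: "G \<in> forms d" and j: "coeff G j \<noteq> 0"
  obtains c where "coeff (E - bscale c G) j = 0"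
proof
  have zero: "coeff (coeff H j) i = 0" if "H \<in> forms d" "i \<noteq> d - j" for H i
    using that by (force simp: forms_def)
  let ?c = "coeff (coeff E j) (d - j) / coeff (coeff G j) (d - j)"
  have "coeff (coeff G j) (d - j) \<noteq> 0"
    using j zero[OF G] by (metis leading_coeff_0_iff)
  show "coeff (E - bscale ?c G) j = 0"
  proof (rule poly_eqI)
    fix i
    show "coeff (coeff (E - bscale ?c G) j) i = coeff 0 i"
      using \<open>coeff (coeff G j) (d - j) \<noteq> 0\<close> zero[OF E, of i] zero[OF G, of i]
      by (cases "i = d - j") (simp_all add: bscale_def)
  qed
qed

text \<open>Were \<open>F\<close> outside the span, elimination would give three nonzero combinations of \<open>A\<close>, \<open>B\<close>, \<open>F\<close> of
  pairwise distinct degrees in \<open>x1\<close> and with the same Wronskian. The coefficient at the leading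
  position of \<open>A\<close> is cleared before the one at that of \<open>B'\<close>, since \<open>B'\<close> vanishes at the former and so
  the second step preserves the first.\<close>

lemma wronskian3_eq_0_imp_in_span:
  assumes A: "A \<in> forms d" and B: "B \<in> forms d" and F: "F \<in> forms d"
    and AB: "A \<noteq> B" "bipoly.independent {A, B}" and W: "wronskian3 A B F = 0"
  shows "F \<in> bipoly.span {A, B}"
proof -
  have A0: "A \<noteq> 0" using AB(2) bipoly.dependent_zero by blast
  then have lcA: "lead_coeff A \<noteq> 0" by simp
  obtain c where c: "coeff (B - bscale c A) (degree A) = 0"
    using forms_eliminate[OF B A lcA] .
  define B' where "B' = B - bscale c A"
  have "B \<notin> bipoly.span {A}"
    using AB bipoly.dependent_def[of "{A, B}"] by (auto simp: insert_Diff_if)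
  moreover have "bscale c A \<in> bipoly.span {A}"
    by (simp add: bipoly.span_base bipoly.span_scale)
  ultimately have B'0: "B' \<noteq> 0" by (auto simp: B'_def)
  have B': "B' \<in> forms d" unfolding B'_def using A B by (rule forms_diff_bscale[rotated])
  obtain a where a: "coeff (F - bscale a A) (degree A) = 0"
    using forms_eliminate[OF F A lcA] .
  have F1: "F - bscale a A \<in> forms d" using F A by (rule forms_diff_bscale)
  have lcB: "lead_coeff B' \<noteq> 0" using B'0 by simp
  obtain b where b: "coeff (F - bscale a A - bscale b B') (degree B') = 0"
    using forms_eliminate[OF F1 B' lcB] .
  define F' where "F' = F - bscale a A - bscale b B'"
  have "wronskian3 A B' F' = 0"
    using W unfolding F'_def B'_def bscale_def wronskian3_reduce .
  moreover have "coeff B' (degree A) = 0" "coeff F' (degree A) = 0" "coeff F' (degree B') = 0"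
    using a b c by (simp_all add: B'_def F'_def bscale_def)
  ultimately have "F' = 0"
    using wronskian3_nonzero[of A B' F'] A0 B'0 by (metis leading_coeff_0_iff)
  then have "F = bscale a A + bscale b (B - bscale c A)"
    by (simp add: F'_def B'_def diff_eq_eq add.commute)
  then show ?thesis
    by (simp add: bipoly.span_add bipoly.span_diff bipoly.span_scale bipoly.span_base)
qed

lemma in_span_imp_wronskian3_eq_0:
  assumes "F \<in> bipoly.span {A, B}"
  shows "wronskian3 A B F = 0"
proof -
  obtain a b where "F = bscale a A + bscale b B"
    using assms by (auto simp: bipoly.span_insert[of A] bipoly.span_singleton)
      (metis diff_add_cancel add.commute)
  then show ?thesis by (simp add: bscale_def wronskian3_comb)
qed

theorem corollary3p3:
  fixes d :: nat and A B T1 T3 F :: bipoly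
  assumes "d \<ge> 2"
    and "A \<in> forms d" and "B \<in> forms d"
    and "A \<noteq> B" and "bipoly.independent {A, B}"
    and "T1 = transvectant d d 1 A B"
    and "T3 = transvectant d d 3 A B"
    and "F \<in> forms d"
  shows "F \<in> bipoly.span {A, B} \<longleftrightarrow>
    transvectant (2 * d - 2) d 2 T1 F
      - bscale ((of_nat d - 2) / (4 * of_nat d - 6)) (T3 * F) = 0"
proof -
  obtain n where n: "d = n + 2" using \<open>d \<ge> 2\<close> by (metis add.commute le_Suc_ex)
  have "of_nat d \<noteq> (0::complex)" "of_nat d - 1 \<noteq> (0::complex)"
    using \<open>d \<ge> 2\<close> by (auto simp flip: of_nat_diff)
  then have "transvectant (2 * d - 2) d 2 T1 F
      - bscale ((of_nat d - 2) / (4 * of_nat d - 6)) (T3 * F) = 0 \<longleftrightarrow> second_partials_det A B F = 0"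
    unfolding assms(6,7)
    unfolding transvectant_identity[OF assms(2,3,8,1)]
    by (subst bipoly.scale_eq_0_iff) simp
  also have "\<dots> \<longleftrightarrow> wronskian3 A B F = 0"
    using assms by (intro second_partials_det_eq_0_iff) (simp_all add: n)
  also have "\<dots> \<longleftrightarrow> F \<in> bipoly.span {A, B}"
    using wronskian3_eq_0_imp_in_span in_span_imp_wronskian3_eq_0 assms by blast
  finally show ?thesis ..
qed

end
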